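(* Let $\theta,p$ be positive integers and let $\{P_n^{(\alpha)}(x)\},\{Q_n^{(\alpha)}(x)\}$ ($n\in\mathbb{N}$, $\alpha\in\mathbb{Z}$) be the adjacent families of monic matrix-valued $\theta$-deformed bi-orthogonal polynomials with normalization factors $H_n^{(\alpha)}\in \mathrm{GL}_p(\mathbb{R})$ (see context). Put $$\omega_{n+1}^{(\alpha)}=H_n^{(\alpha+1)}\left(H_n^{(\alpha)}\right)^{-1}\ (n\ge0),\qquad \varepsilon_n^{(\alpha)}=H_n^{(\alpha)}\left(H_{n-1}^{(\alpha+\theta)}\right)^{-1}\ (n\ge1),\qquad \varepsilon_0^{(\alpha)}=0,$$ and let $\mathscr{A}^{(\alpha)}$ be the semi-infinite block upper bidiagonal matrix with diagonal blocks $\omega_1^{(\alpha)},\omega_2^{(\alpha)},\dots$ and superdiagonal blocks $\mathbb{I}_p$, and $\mathscr{B}^{(\alpha)}$ the semi-infinite block lower bidiagonal matrix with diagonal blocks $\mathbb{I}_p$ and subdiagonal blocks $\varepsilon_1^{(\alpha)},\varepsilon_2^{(\alpha)},\dots$. Then for all $\alpha\in\mathbb{Z}$ $$\mathscr{A}^{(\alpha)}\mathscr{B}^{(\alpha)}=\mathscr{B}^{(\alpha+1)}\mathscr{A}^{(\alpha+\theta)},$$ or equivalently, for all $n\ge1$ and $\alpha\in\mathbb{Z}$, the discrete non-commutative hungry Toda-I lattice holds: $$\omega_{n+1}^{(\alpha)}\varepsilon_n^{(\alpha)}=\varepsilon_n^{(\alpha+1)}\omega_n^{(\alpha+\theta)},\qquad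 \omega_n^{(\alpha+\theta)}+\varepsilon_{n-1}^{(\alpha+1)}=\omega_n^{(\alpha)}+\varepsilon_n^{(\alpha)}.$$
   Context: Let $W:\mathbb{R}\to\mathbb{R}^{p\times p}$ be a matrix-valued weight function. For $\alpha\in\mathbb{Z}$ and $f,g\in\mathbb{R}^{p\times p}[x]$ define $$\langle f(x),g(x)\rangle_\theta^{\alpha}=\int_{\mathbb{R}}f(x)\,x^{\alpha}W(x)\,g^{\top}(x^{\theta})\,dx,$$ where $g^\top(x^\theta)$ is the transpose of $g$ evaluated at $x^\theta$. Standing (moment) assumption: all moments $m_k=\int_{\mathbb{R}}x^kW(x)\,dx$, $k\in\mathbb{Z}$, exist and are finite, and for every $\alpha\in\mathbb{Z}$ and $n\in\mathbb{N}$ the block moment matrix $(m_{\alpha+i+j\theta})_{i,j=0}^{n}$ is invertible. Then for each $\alpha$ there are unique sequences of monic matrix-valued polynomials $P_n^{(\alpha)},Q_n^{(\alpha)}\in\mathbb{R}^{p\times p}[x]$ (leading coefficient the identity $\mathbb{I}_p$) of degree $n$ with $$\langle P_n^{(\alpha)}(x),Q_m^{(\alpha)}(x)\rangle_\theta^{\alpha}=H_n^{(\alpha)}\delta_{n,m},\qquad n,m\in\mathbb{N},$$ with $H_n^{(\alpha)}\in\mathrm{GL}_p(\mathbb{R})$. *)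

theory Defs
  imports "HOL-Analysis.Analysis" "HOL-Computational_Algebra.Polynomial"
begin

text \<open>
  A matrix-valued polynomial is an element of the library type of polynomials with coefficients
  in \<open>real^'p^'p\<close>; only its coefficients and degree are used.  The library's \<open>poly\<close> and the
  polynomial product are avoided, because \<open>*\<close> on \<open>real^'p^'p\<close> is the entrywise product; the
  matrix product is \<open>**\<close>.
\<close>

definition mpoly_eval :: "(real^'p^'p) poly \<Rightarrow> real \<Rightarrow> real^'p^'p" where
  "mpoly_eval f x = (\<Sum>i\<le>degree f. x ^ i *\<^sub>R coeff f i)"

definition monic_of_degree :: "nat \<Rightarrow> (real^'p^'p) poly \<Rightarrow> bool" where
  "monic_of_degree n f \<longleftrightarrow> degree f = n \<and> lead_coeff f = mat 1"

text \<open>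
  For negative exponents the integrands below take the value \<open>0\<close> at the null set \<open>x = 0\<close>.
\<close>

definition pairing ::
  "nat \<Rightarrow> (real \<Rightarrow> real^'p^'p) \<Rightarrow> int \<Rightarrow> (real^'p^'p) poly \<Rightarrow> (real^'p^'p) poly \<Rightarrow> real^'p^'p" where
  "pairing \<theta> W \<alpha> f g =
     (LINT x|lebesgue. mpoly_eval f x ** (x powi \<alpha> *\<^sub>R W x) ** transpose (mpoly_eval g (x ^ \<theta>)))"

definition finite_moments :: "(real \<Rightarrow> real^'p^'p) \<Rightarrow> bool" where
  "finite_moments W \<longleftrightarrow> (\<forall>k::int. integrable lebesgue (\<lambda>x. x powi k *\<^sub>R W x))"

definition moment :: "(real \<Rightarrow> real^'p^'p) \<Rightarrow> int \<Rightarrow> real^'p^'p" where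
  "moment W k = (LINT x|lebesgue. x powi k *\<^sub>R W x)"

text \<open>
  Invertibility of the block matrix with blocks \<open>M i j\<close>, \<open>0 \<le> i, j \<le> n\<close>: existence of a two-sided
  inverse, partitioned into blocks in the same way and multiplied blockwise.
\<close>

definition block_invertible :: "nat \<Rightarrow> (nat \<Rightarrow> nat \<Rightarrow> real^'p^'p) \<Rightarrow> bool" where
  "block_invertible n M \<longleftrightarrow>
     (\<exists>N. \<forall>i\<le>n. \<forall>j\<le>n.
        (\<Sum>k\<le>n. M i k ** N k j) = (if i = j then mat 1 else 0) \<and>
        (\<Sum>k\<le>n. N i k ** M k j) = (if i = j then mat 1 else 0))"

definition adjacent_biorthogonal ::
  "nat \<Rightarrow> (real \<Rightarrow> real^'p^'p) \<Rightarrow> (int \<Rightarrow> nat \<Rightarrow> (real^'p^'p) poly) \<Rightarrow>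
   (int \<Rightarrow> nat \<Rightarrow> (real^'p^'p) poly) \<Rightarrow> (int \<Rightarrow> nat \<Rightarrow> real^'p^'p) \<Rightarrow> bool" where
  "adjacent_biorthogonal \<theta> W P Q H \<longleftrightarrow>
     (\<forall>\<alpha> n. monic_of_degree n (P \<alpha> n) \<and> monic_of_degree n (Q \<alpha> n) \<and> invertible (H \<alpha> n)) \<and>
     (\<forall>\<alpha> n m. pairing \<theta> W \<alpha> (P \<alpha> n) (Q \<alpha> m) = (if n = m then H \<alpha> n else 0))"

text \<open>Only the values of \<open>omega\<close> at \<open>n \<ge> 1\<close> are meaningful.\<close>

definition omega :: "(int \<Rightarrow> nat \<Rightarrow> real^'p^'p) \<Rightarrow> int \<Rightarrow> nat \<Rightarrow> real^'p^'p" where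
  "omega H \<alpha> n = H (\<alpha> + 1) (n - 1) ** matrix_inv (H \<alpha> (n - 1))"

definition epsilon :: "nat \<Rightarrow> (int \<Rightarrow> nat \<Rightarrow> real^'p^'p) \<Rightarrow> int \<Rightarrow> nat \<Rightarrow> real^'p^'p" where
  "epsilon \<theta> H \<alpha> n = (if n = 0 then 0 else H \<alpha> n ** matrix_inv (H (\<alpha> + int \<theta>) (n - 1)))"

text \<open>
  Semi-infinite block matrices are functions of a row and a column index, both starting at \<open>0\<close>.
\<close>

type_synonym 'p block_matrix = "nat \<Rightarrow> nat \<Rightarrow> real^'p^'p"

definition scrA :: "(int \<Rightarrow> nat \<Rightarrow> real^'p^'p) \<Rightarrow> int \<Rightarrow> 'p block_matrix" where
  "scrA H \<alpha> i j = (if j = i then omega H \<alpha> (i + 1) else if j = i + 1 then mat 1 else 0)"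

definition scrB :: "nat \<Rightarrow> (int \<Rightarrow> nat \<Rightarrow> real^'p^'p) \<Rightarrow> int \<Rightarrow> 'p block_matrix" where
  "scrB \<theta> H \<alpha> i j = (if j = i then mat 1 else if i = j + 1 then epsilon \<theta> H \<alpha> i else 0)"

text \<open>
  The sum runs over the nonzero terms; there are finitely many of them as soon as the first
  factor has finitely many nonzero blocks in each row, as bidiagonal matrices do.
\<close>

definition block_mult ::
  "'p::finite block_matrix \<Rightarrow> 'p block_matrix \<Rightarrow> 'p block_matrix" where
  "block_mult A B i j = (\<Sum>k | A i k ** B k j \<noteq> 0. A i k ** B k j)"

end

(* Write a(\<alpha>, n) for the coefficient of x^(n - 1) in P_n^(\<alpha>).  Since a polynomial of degree at most n
   pairs with Q_n to its n-th coefficient times H_n, pairing x P_n^(\<alpha>+1) - P_(n+1)^(\<alpha>) with Q_n^(\<alpha>)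
   gives \<omega>_(n+1)^(\<alpha>) = a(\<alpha>+1, n) - a(\<alpha>, n+1), and pairing P_n^(\<alpha>) - P_n^(\<alpha>+\<theta>) with
   Q_(n-1)^(\<alpha>+\<theta>) gives \<epsilon>_n^(\<alpha>) = a(\<alpha>, n) - a(\<alpha>+\<theta>, n).  With these formulas the additive equation
   telescopes; the multiplicative one is mere cancellation of normalization factors. *)

theory Submission
  imports Defs
begin

section \<open>Algebra of real matrices\<close>

interpretation matrix_mult: bounded_bilinear "\<lambda>(A :: real^'n^'m) (B :: real^'k^'n). A ** B"
  by (simp flip: bilinear_conv_bounded_bilinear
      add: bilinear_def linear_iff matrix_add_ldistrib
        scalar_matrix_assoc matrix_scalar_ac)
    (simp add: matrix_matrix_mult_def vec_eq_iff sum.distrib distrib_right)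

lemma linear_transpose: "linear (transpose :: real^'n^'m \<Rightarrow> real^'m^'n)"
  by (simp add: linear_iff transpose_def vec_eq_iff)

lemma matrix_inv_inverse:
  fixes A :: "real^'n^'n"
  assumes "invertible A"
  shows "A ** matrix_inv A = mat 1" "matrix_inv A ** A = mat 1"
  using someI_ex[OF assms[unfolded invertible_def]] by (simp_all add: matrix_inv_def)

lemma right_cancel_matrix_inv:
  fixes A B C :: "real^'n^'n"
  assumes "invertible A" "B ** A = C"
  shows "C ** matrix_inv A = B"
  by (metis assms matrix_inv_inverse(1) matrix_mul_assoc matrix_mul_rid)

section \<open>The pairing in terms of moments\<close>

lemma mpoly_eval_bound:
  assumes "degree f \<le> N"
  shows "mpoly_eval f x = (\<Sum>i\<le>N. x ^ i *\<^sub>R coeff f i)"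
  unfolding mpoly_eval_def
  using assms by (intro sum.mono_neutral_left) (auto simp: coeff_eq_0)

text \<open>This removes the integral for good: all later laws of the pairing are identities between
  finite sums. The bounds \<open>N\<close> and \<open>M\<close> need not be the exact degrees, so
  that polynomials of different degree can share one index range.\<close>

lemma pairing_eq_moments:
  fixes W :: "real \<Rightarrow> real^'p^'p"
  assumes W: "finite_moments W" and f: "degree f \<le> N" and g: "degree g \<le> M"
  shows "pairing \<theta> W \<alpha> f g =
    (\<Sum>i\<le>N. \<Sum>j\<le>M. coeff f i ** moment W (\<alpha> + int i + int j * int \<theta>) ** transpose (coeff g j))"
proof -
  let ?V = "\<lambda>i j x. x powi (\<alpha> + int i + int j * int \<theta>) *\<^sub>R W x"
  have bl: "bounded_linear (\<lambda>X. A ** X ** B)" for A B :: "real^'p^'p"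
    by (rule bounded_linear_compose[OF matrix_mult.bounded_linear_left
          matrix_mult.bounded_linear_right])
  have V: "integrable lebesgue (?V i j)" for i j
    using W unfolding finite_moments_def by blast
  have integrand: "mpoly_eval f x ** (x powi \<alpha> *\<^sub>R W x) ** transpose (mpoly_eval g (x ^ \<theta>)) =
      (\<Sum>i\<le>N. \<Sum>j\<le>M. coeff f i ** ?V i j x ** transpose (coeff g j))" if "x \<noteq> 0" for x
  proof -
    \<comment> \<open>Splitting the exponent fails at 0 when \<alpha> is negative, hence the
      restriction to nonzero \<open>x\<close>.\<close>
    have "x powi (\<alpha> + int i + int j * int \<theta>) = x ^ i * x powi \<alpha> * (x ^ \<theta>) ^ j" for i j
      using that by (simp add: power_int_add power_int_mult power_mult mult.commute
          flip: power_int_of_nat)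
    then show ?thesis
      unfolding mpoly_eval_bound[OF f] mpoly_eval_bound[OF g] linear_sum[OF linear_transpose]
      by (simp add: matrix_mult.sum_left matrix_mult.sum_right linear_cmul[OF linear_transpose]
          matrix_mult.scaleR_left matrix_mult.scaleR_right scaleR_sum_right mult.commute mult.left_commute
          sum.swap[of _ "{..M}" "{..N}"])
  qed
  let ?L = "\<lambda>x. mpoly_eval f x ** (x powi \<alpha> *\<^sub>R W x) ** transpose (mpoly_eval g (x ^ \<theta>))"
  let ?R = "\<lambda>x. \<Sum>i\<le>N. \<Sum>j\<le>M. coeff f i ** ?V i j x ** transpose (coeff g j)"
  have R: "?R \<in> borel_measurable lebesgue"
    by (intro borel_measurable_sum borel_measurable_integrable integrable_bounded_linear[OF bl V])
  \<comment> \<open>\<open>integral_cong_AE\<close> asks for measurability of both integrands; that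
    of \<open>?L\<close> is inherited from \<open>?R\<close>, from which it can differ only at
    0.\<close>
  have "(\<lambda>x. if x = 0 then ?L 0 else ?R x) \<in> borel_measurable lebesgue"
    using R by (intro measurable_If) auto
  also have "(\<lambda>x. if x = 0 then ?L 0 else ?R x) = ?L"
    using integrand by (intro ext) auto
  finally have L: "?L \<in> borel_measurable lebesgue" .
  have "AE x in lebesgue. x \<noteq> (0::real)"
    by (rule AE_I'[of "{0}"]) auto
  then have "AE x in lebesgue. ?L x = ?R x"
    using integrand by (auto elim: eventually_mono)
  then have "pairing \<theta> W \<alpha> f g = (LINT x|lebesgue. ?R x)"
    unfolding pairing_def by (rule integral_cong_AE[OF L R])
  also have "\<dots> = (\<Sum>i\<le>N. \<Sum>j\<le>M. coeff f i ** moment W (\<alpha> + int i + int j * int \<theta>) **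
      transpose (coeff g j))"
    by (simp add: integrable_bounded_linear[OF bl V] integral_bounded_linear[OF bl V] moment_def)
  finally show ?thesis .
qed

lemma pairing_diff_left:
  assumes "finite_moments W"
  shows "pairing \<theta> W \<alpha> (f - f') g = pairing \<theta> W \<alpha> f g - pairing \<theta> W \<alpha> f' g"
proof -
  let ?N = "max (degree f) (degree f')"
  have "degree (f - f') \<le> ?N" by (rule degree_diff_le_max)
  then show ?thesis
    by (simp add: pairing_eq_moments[OF assms, of _ ?N g "degree g"] matrix_mult.diff_left
        sum_subtractf)
qed

lemma pairing_diff_right:
  assumes "finite_moments W"
  shows "pairing \<theta> W \<alpha> f (g - g') = pairing \<theta> W \<alpha> f g - pairing \<theta> W \<alpha> f g'"
proof -
  let ?M = "max (degree g) (degree g')"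
  have "degree (g - g') \<le> ?M" by (rule degree_diff_le_max)
  then show ?thesis
    by (simp add: pairing_eq_moments[OF assms, of f "degree f" _ ?M] matrix_mult.diff_right
        linear_diff[OF linear_transpose] sum_subtractf)
qed

text \<open>Mapping the coefficients encodes left multiplication by a constant matrix, because the
  product of the polynomial type is built on the entrywise \<open>*\<close>.\<close>

lemma pairing_mult_left:
  assumes "finite_moments W"
  shows "pairing \<theta> W \<alpha> (map_poly (\<lambda>B. A ** B) f) g = A ** pairing \<theta> W \<alpha> f g"
  by (simp add: pairing_eq_moments[OF assms, of _ "degree f" g "degree g"] map_poly_degree_leq
      coeff_map_poly matrix_mult.sum_right matrix_mul_assoc)

lemma pairing_mult_right:
  assumes "finite_moments W"
  shows "pairing \<theta> W \<alpha> f (map_poly (\<lambda>B. A ** B) g) = pairing \<theta> W \<alpha> f g ** transpose A"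
  by (simp add: pairing_eq_moments[OF assms, of f "degree f" _ "degree g"] map_poly_degree_leq
      coeff_map_poly matrix_mult.sum_left matrix_transpose_mul matrix_mul_assoc)

lemma pairing_pCons_left:
  assumes "finite_moments W"
  shows "pairing \<theta> W \<alpha> (pCons 0 f) g = pairing \<theta> W (\<alpha> + 1) f g"
proof -
  have "degree (pCons 0 f) \<le> Suc (degree f)" by (rule degree_pCons_le)
  then show ?thesis
    by (simp add: pairing_eq_moments[OF assms, of "pCons 0 f" "Suc (degree f)" g "degree g"]
        pairing_eq_moments[OF assms, of f "degree f" g "degree g"] sum.atMost_Suc_shift
        del: sum.atMost_Suc) (simp add: algebra_simps)
qed

text \<open>The second argument is evaluated at x^\<theta>, so an extra factor x there raises the
  exponent of the weight by \<theta>, whereas in the first argument it raises it by 1.\<close>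

lemma pairing_pCons_right:
  assumes "finite_moments W"
  shows "pairing \<theta> W \<alpha> f (pCons 0 g) = pairing \<theta> W (\<alpha> + int \<theta>) f g"
proof -
  have "degree (pCons 0 g) \<le> Suc (degree g)" by (rule degree_pCons_le)
  then show ?thesis
    by (simp add: pairing_eq_moments[OF assms, of f "degree f" "pCons 0 g" "Suc (degree g)"]
        pairing_eq_moments[OF assms, of f "degree f" g "degree g"] sum.atMost_Suc_shift
        linear_0[OF linear_transpose]
        del: sum.atMost_Suc) (simp add: algebra_simps)
qed

text \<open>One step of division by a monic polynomial: the terms of degree \<open>n\<close> cancel.
  It drives the expansions in the bases \<open>P\<close> and \<open>Q\<close> below.\<close>

lemma degree_diff_monic_mult:
  assumes f: "degree f \<le> n" and p: "monic_of_degree n p" and "n > 0"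
  shows "degree (f - map_poly (\<lambda>B. coeff f n ** B) p) \<le> n - 1"
proof (rule degree_le, intro allI impI)
  fix i assume i: "n - 1 < i"
  show "coeff (f - map_poly (\<lambda>B. coeff f n ** B) p) i = 0"
  proof (cases "i = n")
    case True
    then show ?thesis using p by (auto simp: monic_of_degree_def coeff_map_poly)
  next
    case False
    then have "i > n" using i by linarith
    then show ?thesis
      using f p by (simp add: monic_of_degree_def coeff_map_poly coeff_eq_0)
  qed
qed

lemma degree_0_eq_monic_mult:
  assumes "degree f \<le> 0" "monic_of_degree 0 p"
  shows "f = map_poly (\<lambda>B. coeff f 0 ** B) p"
proof (rule poly_eqI)
  fix i show "coeff f i = coeff (map_poly (\<lambda>B. coeff f 0 ** B) p) i"
    using assms by (cases i) (auto simp: monic_of_degree_def coeff_map_poly coeff_eq_0)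
qed

section \<open>Bi-orthogonality and the lattice equations\<close>

context
  fixes \<theta> :: nat
    and W :: "real \<Rightarrow> real^'p^'p"
    and P Q :: "int \<Rightarrow> nat \<Rightarrow> (real^'p^'p) poly"
    and H :: "int \<Rightarrow> nat \<Rightarrow> real^'p^'p"
  assumes moments: "finite_moments W"
    and biorthogonal: "adjacent_biorthogonal \<theta> W P Q H"
begin

lemma
  shows monic_P: "monic_of_degree n (P \<alpha> n)"
    and monic_Q: "monic_of_degree n (Q \<alpha> n)"
    and invertible_H: "invertible (H \<alpha> n)"
    and pairing_P_Q: "pairing \<theta> W \<alpha> (P \<alpha> n) (Q \<alpha> m) = (if n = m then H \<alpha> n else 0)"
  using biorthogonal by (simp_all add: adjacent_biorthogonal_def)

lemma
  shows degree_P: "degree (P \<alpha> n) = n"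
    and coeff_P: "coeff (P \<alpha> n) n = mat 1"
    and degree_Q: "degree (Q \<alpha> n) = n"
    and coeff_Q: "coeff (Q \<alpha> n) n = mat 1"
  using monic_P[of n \<alpha>] monic_Q[of n \<alpha>] by (auto simp: monic_of_degree_def)

lemma pairing_Q:
  assumes "degree f \<le> n"
  shows "pairing \<theta> W \<alpha> f (Q \<alpha> n) = coeff f n ** H \<alpha> n"
proof -
  \<comment> \<open>The degree bound \<open>k\<close> varies while \<open>Q \<alpha> n\<close> stays
    fixed: subtracting multiples of \<open>P \<alpha> k\<close> lowers the degree, and only the one
    with \<open>k = n\<close> contributes.\<close>
  have *: "pairing \<theta> W \<alpha> f (Q \<alpha> n) = (if k = n then coeff f n ** H \<alpha> n else 0)"
    if "degree f \<le> k" "k \<le> n" for f k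
    using that
  proof (induction k arbitrary: f)
    case 0
    then have "pairing \<theta> W \<alpha> f (Q \<alpha> n) =
        pairing \<theta> W \<alpha> (map_poly (\<lambda>B. coeff f 0 ** B) (P \<alpha> 0)) (Q \<alpha> n)"
      using degree_0_eq_monic_mult[OF _ monic_P] by metis
    then show ?case
      by (simp add: pairing_mult_left[OF moments] pairing_P_Q)
  next
    case (Suc k)
    let ?cP = "map_poly (\<lambda>B. coeff f (Suc k) ** B) (P \<alpha> (Suc k))"
    have "pairing \<theta> W \<alpha> (f - ?cP) (Q \<alpha> n) = 0"
      using Suc.IH[of "f - ?cP"] degree_diff_monic_mult[OF Suc.prems(1) monic_P] Suc.prems(2)
      by simp
    then show ?case
      by (simp add: pairing_diff_left[OF moments] pairing_mult_left[OF moments] pairing_P_Q)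
  qed
  from *[OF assms order_refl] show ?thesis by simp
qed

lemma pairing_P:
  assumes "degree g \<le> n"
  shows "pairing \<theta> W \<alpha> (P \<alpha> n) g = H \<alpha> n ** transpose (coeff g n)"
proof -
  have *: "pairing \<theta> W \<alpha> (P \<alpha> n) g = (if k = n then H \<alpha> n ** transpose (coeff g n) else 0)"
    if "degree g \<le> k" "k \<le> n" for g k
    using that
  proof (induction k arbitrary: g)
    case 0
    then have "pairing \<theta> W \<alpha> (P \<alpha> n) g =
        pairing \<theta> W \<alpha> (P \<alpha> n) (map_poly (\<lambda>B. coeff g 0 ** B) (Q \<alpha> 0))"
      using degree_0_eq_monic_mult[OF _ monic_Q] by metis
    then show ?case
      by (simp add: pairing_mult_right[OF moments] pairing_P_Q)
  next
    case (Suc k)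
    let ?cQ = "map_poly (\<lambda>B. coeff g (Suc k) ** B) (Q \<alpha> (Suc k))"
    have "pairing \<theta> W \<alpha> (P \<alpha> n) (g - ?cQ) = 0"
      using Suc.IH[of "g - ?cQ"] degree_diff_monic_mult[OF Suc.prems(1) monic_Q] Suc.prems(2)
      by simp
    then show ?case
      by (simp add: pairing_diff_right[OF moments] pairing_mult_right[OF moments] pairing_P_Q)
  qed
  from *[OF assms order_refl] show ?thesis by simp
qed

text \<open>Writing the first term with \<open>pCons 0\<close> covers \<open>n = 0\<close> as well,
  where the coefficient of x^(n - 1) is to be read as 0.\<close>

lemma omega_eq_coeff:
  "omega H \<alpha> (Suc n) = coeff (pCons 0 (P (\<alpha> + 1) n)) n - coeff (P \<alpha> (Suc n)) n"
proof -
  let ?R = "pCons 0 (P (\<alpha> + 1) n) - P \<alpha> (Suc n)"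
  have "degree ?R \<le> n"
  proof (rule degree_le, intro allI impI)
    fix i assume "n < i"
    then obtain k where k: "i = Suc k" "n \<le> k" by (cases i) auto
    show "coeff ?R i = 0"
    proof (cases "k = n")
      case True
      then show ?thesis using k by (simp add: coeff_P)
    next
      case False
      then show ?thesis using k by (simp add: coeff_eq_0 degree_P)
    qed
  qed
  then have "pairing \<theta> W \<alpha> ?R (Q \<alpha> n) = coeff ?R n ** H \<alpha> n"
    by (rule pairing_Q)
  \<comment> \<open>After the shift, \<open>P (\<alpha> + 1) n\<close> faces
    \<open>Q \<alpha> n\<close> from another family; \<open>pairing_P\<close> still applies, since
    it asks only for the degree and leading coefficient.\<close>
  moreover have "pairing \<theta> W \<alpha> ?R (Q \<alpha> n) = H (\<alpha> + 1) n"
    by (simp add: pairing_diff_left[OF moments] pairing_pCons_left[OF moments] pairing_P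
        pairing_P_Q degree_Q coeff_Q)
  ultimately have "coeff ?R n ** H \<alpha> n = H (\<alpha> + 1) n" by simp
  from right_cancel_matrix_inv[OF invertible_H this] show ?thesis
    by (simp add: omega_def)
qed

lemma epsilon_eq_coeff:
  "epsilon \<theta> H \<alpha> (Suc n) = coeff (P \<alpha> (Suc n)) n - coeff (P (\<alpha> + int \<theta>) (Suc n)) n"
proof -
  let ?\<beta> = "\<alpha> + int \<theta>"
  let ?R = "P \<alpha> (Suc n) - P ?\<beta> (Suc n)"
  have "degree ?R \<le> n"
  proof (rule degree_le, intro allI impI)
    fix i assume "n < i"
    then show "coeff ?R i = 0"
      by (cases "i = Suc n") (auto simp: coeff_P coeff_eq_0 degree_P)
  qed
  then have "pairing \<theta> W ?\<beta> ?R (Q ?\<beta> n) = coeff ?R n ** H ?\<beta> n"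
    by (rule pairing_Q)
  \<comment> \<open>Lowering the weight exponent from \<open>?\<beta>\<close> to \<alpha> turns
    \<open>Q ?\<beta> n\<close> into a monic polynomial of degree \<open>Suc n\<close>.\<close>
  moreover have "pairing \<theta> W ?\<beta> (P \<alpha> (Suc n)) (Q ?\<beta> n) = H \<alpha> (Suc n)"
    using pairing_P[of "pCons 0 (Q ?\<beta> n)" "Suc n" \<alpha>] degree_pCons_le[of 0 "Q ?\<beta> n"]
    by (simp add: pairing_pCons_right[OF moments] degree_Q coeff_Q)
  ultimately have "coeff ?R n ** H ?\<beta> n = H \<alpha> (Suc n)"
    by (simp add: pairing_diff_left[OF moments] pairing_P_Q)
  from right_cancel_matrix_inv[OF invertible_H this] show ?thesis
    by (simp add: epsilon_def)
qed

lemma toda_additive: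
  "omega H (\<alpha> + int \<theta>) (Suc n) + epsilon \<theta> H (\<alpha> + 1) n =
    omega H \<alpha> (Suc n) + epsilon \<theta> H \<alpha> (Suc n)"
proof (cases n)
  \<comment> \<open>The convention \<epsilon>_0 = 0 enters here, as \<open>epsilon_eq_coeff\<close>
    covers positive indices only.\<close>
  case 0
  then show ?thesis
    by (simp add: omega_eq_coeff epsilon_eq_coeff) (simp add: epsilon_def)
next
  case (Suc m)
  then show ?thesis
    by (simp add: omega_eq_coeff epsilon_eq_coeff add_ac)
qed

text \<open>Both sides collapse to \<open>H (\<alpha> + 1) (Suc n) ** matrix_inv (H (\<alpha> + int
  \<theta>) n)\<close>.\<close>

lemma toda_multiplicative:
  "omega H \<alpha> (Suc (Suc n)) ** epsilon \<theta> H \<alpha> (Suc n) =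
    epsilon \<theta> H (\<alpha> + 1) (Suc n) ** omega H (\<alpha> + int \<theta>) (Suc n)"
proof -
  have cancel: "A ** matrix_inv (H \<beta> k) ** (H \<beta> k ** B) = A ** B" for A B \<beta> k
    by (metis matrix_inv_inverse(2)[OF invertible_H] matrix_mul_assoc matrix_mul_lid)
  show ?thesis
    using cancel[of "H (\<alpha> + 1) (Suc n)" "\<alpha> + int \<theta> + 1" n "matrix_inv (H (\<alpha> + int \<theta>) n)"]
    by (simp add: omega_def epsilon_def cancel add_ac)
qed

end

section \<open>Block matrix form\<close>

lemma block_mult_eq_sum:
  assumes "finite K" "\<And>k. k \<notin> K \<Longrightarrow> A i k = 0"
  shows "block_mult A B i j = (\<Sum>k\<in>K. A i k ** B k j)"
  unfolding block_mult_def
  using assms by (intro sum.mono_neutral_left) (auto, metis matrix_mult.zero_left)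

lemma block_mult_scrA:
  "block_mult (scrA H \<alpha>) B i j = omega H \<alpha> (Suc i) ** B i j + B (Suc i) j"
  by (subst block_mult_eq_sum[of "{i, Suc i}"]) (auto simp: scrA_def)

lemma block_mult_scrB:
  "block_mult (scrB \<theta> H \<alpha>) C i j =
    C i j + (case i of 0 \<Rightarrow> 0 | Suc k \<Rightarrow> epsilon \<theta> H \<alpha> i ** C k j)"
  \<comment> \<open>In row 0 truncated subtraction collapses the index set to a singleton, matching
    the absence of a subdiagonal block.\<close>
  by (subst block_mult_eq_sum[of "{i, i - 1}"]) (auto simp: scrB_def split: nat.split)

theorem mainTheorem4:
  fixes \<theta> :: nat
    and W :: "real \<Rightarrow> real^'p^'p"
    and P Q :: "int \<Rightarrow> nat \<Rightarrow> (real^'p^'p) poly"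
    and H :: "int \<Rightarrow> nat \<Rightarrow> real^'p^'p"
  assumes "\<theta> \<ge> 1"
    and "finite_moments W"
    and "\<And>(\<alpha>::int) (n::nat).
           block_invertible n (\<lambda>i j. moment W (\<alpha> + int i + int j * int \<theta>))"
    and "adjacent_biorthogonal \<theta> W P Q H"
  shows "(\<forall>\<alpha>. block_mult (scrA H \<alpha>) (scrB \<theta> H \<alpha>) =
               block_mult (scrB \<theta> H (\<alpha> + 1)) (scrA H (\<alpha> + int \<theta>))) \<and>
         (\<forall>\<alpha>. \<forall>n\<ge>1.
            omega H \<alpha> (n + 1) ** epsilon \<theta> H \<alpha> n =
              epsilon \<theta> H (\<alpha> + 1) n ** omega H (\<alpha> + int \<theta>) n \<and>
            omega H (\<alpha> + int \<theta>) n + epsilon \<theta> H (\<alpha> + 1) (n - 1) =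
              omega H \<alpha> n + epsilon \<theta> H \<alpha> n)"
proof -
  note multiplicative = toda_multiplicative[OF assms(2,4)]
  note additive = toda_additive[OF assms(2,4)]
  have "block_mult (scrA H \<alpha>) (scrB \<theta> H \<alpha>) i j =
      block_mult (scrB \<theta> H (\<alpha> + 1)) (scrA H (\<alpha> + int \<theta>)) i j" for \<alpha> i j
  proof (cases i)
    case 0
    then show ?thesis
      using additive[of \<alpha> 0]
      by (auto simp: block_mult_scrA block_mult_scrB) (auto simp: scrA_def scrB_def epsilon_def)
  next
    case (Suc k)
    then show ?thesis
      \<comment> \<open>The additive equation is the diagonal entry and the multiplicative one the
        subdiagonal entry; on the superdiagonal both products have the identity.\<close>
      using additive[of \<alpha> i] multiplicative[of \<alpha> k]
      by (auto simp: block_mult_scrA block_mult_scrB) (auto simp: scrA_def scrB_def add_ac)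
  qed
  moreover have "omega H \<alpha> (n + 1) ** epsilon \<theta> H \<alpha> n =
        epsilon \<theta> H (\<alpha> + 1) n ** omega H (\<alpha> + int \<theta>) n \<and>
      omega H (\<alpha> + int \<theta>) n + epsilon \<theta> H (\<alpha> + 1) (n - 1) =
        omega H \<alpha> n + epsilon \<theta> H \<alpha> n" if "n \<ge> 1" for \<alpha> n
    using that multiplicative[of \<alpha> "n - 1"] additive[of \<alpha> "n - 1"] by simp
  ultimately show ?thesis by blast
qed

end
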